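(* There is an absolute constant $c>0$ such that the following holds. Let $n,d\ge1$ be integers, let $m>0$, $\delta\in(0,1)$, and let $\mathcal{F}$ be a finite nonempty class of (possibly unbounded) measurable functions $\mathbf{R}^d\to\mathbf{R}$. Then there exists an estimator $\widehat g$, depending on $\delta$ and $m$ (and on $\mathcal{F}$, but not on the distribution of the data), such that for every distribution of $(X,Y)$ on $\mathbf{R}^d\times\mathbf{R}$ satisfying $\sup_{x\in\mathbf{R}^d}\mathbf{E}[Y^2\mid X=x]\le m^2$ (with no assumption on the distribution of $X$), the predictor $\widehat g$ computed on an i.i.d. sample of size $n$ satisfies $$\mathbf{P}\left(R(\widehat g)-\min_{g\in\mathcal{F}}R(g)\le c\,\frac{m^2\big(\log|\mathcal{F}|+\log(1/\delta)\big)}{n}\right)\ge1-\delta.$$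
   Context: For measurable $g:\mathbf{R}^d\to\mathbf{R}$ the risk is $R(g)=\mathbf{E}(g(X)-Y)^2$, where $(X,Y)$ is independent of the sample; for a data-dependent $\widehat g$, $R(\widehat g)$ is the (random) risk conditional on the sample. An estimator is a measurable map from samples in $(\mathbf{R}^d\times\mathbf{R})^n$ to measurable functions $\mathbf{R}^d\to\mathbf{R}$; it need not take values in $\mathcal{F}$. *)

theory Defs
  imports "HOL-Probability.Probability"
begin

text \<open>
  The dimension is a bound variable of the main statement (the constant there must not depend on
  it), so a point of \<open>R^d\<close> is an extensional function on \<open>{..<d}\<close>. The product sigma-algebra below
  is the Borel sigma-algebra of \<open>R^d\<close>.
\<close>

definition Rd :: "nat \<Rightarrow> (nat \<Rightarrow> real) measure" where
  "Rd d = PiM {..<d} (\<lambda>_. borel)"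

abbreviation data_space :: "nat \<Rightarrow> ((nat \<Rightarrow> real) \<times> real) measure" where
  "data_space d \<equiv> Rd d \<Otimes>\<^sub>M borel"

abbreviation sample_space :: "nat \<Rightarrow> nat \<Rightarrow> (nat \<Rightarrow> (nat \<Rightarrow> real) \<times> real) measure" where
  "sample_space n d \<equiv> PiM {..<n} (\<lambda>_. data_space d)"

text \<open>
  Extensionality makes functions on \<open>R^d\<close> equal as soon as they agree on \<open>R^d\<close>, so that \<^const>\<open>card\<close>
  counts a class of functions on \<open>R^d\<close> correctly.
\<close>

definition measurable_functions :: "nat \<Rightarrow> ((nat \<Rightarrow> real) \<Rightarrow> real) set" where
  "measurable_functions d = borel_measurable (Rd d) \<inter> extensional (space (Rd d))"

text \<open>
  Measurability of a function-valued map is joint measurability in the sample and the argument.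
\<close>

definition estimator ::
  "nat \<Rightarrow> nat \<Rightarrow> ((nat \<Rightarrow> (nat \<Rightarrow> real) \<times> real) \<Rightarrow> (nat \<Rightarrow> real) \<Rightarrow> real) \<Rightarrow> bool" where
  "estimator n d ghat \<longleftrightarrow>
     (\<forall>s \<in> space (sample_space n d). ghat s \<in> measurable_functions d) \<and>
     (\<lambda>(s, x). ghat s x) \<in> borel_measurable (sample_space n d \<Otimes>\<^sub>M Rd d)"

text \<open>
  The risk may be infinite. With extended real subtraction, \<open>\<infinity> - \<infinity> = \<infinity>\<close>, so an upper bound on a
  difference of risks is never satisfied through an undefined value.
\<close>

definition risk :: "((nat \<Rightarrow> real) \<times> real) measure \<Rightarrow> ((nat \<Rightarrow> real) \<Rightarrow> real) \<Rightarrow> ereal" where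
  "risk P g = enn2ereal (\<integral>\<^sup>+ (x, y). ennreal ((g x - y)\<^sup>2) \<partial>P)"

definition data_distribution :: "nat \<Rightarrow> ((nat \<Rightarrow> real) \<times> real) measure \<Rightarrow> bool" where
  "data_distribution d P \<longleftrightarrow> prob_space P \<and> sets P = sets (data_space d)"

definition sigma_X ::
  "nat \<Rightarrow> ((nat \<Rightarrow> real) \<times> real) measure \<Rightarrow> ((nat \<Rightarrow> real) \<times> real) measure" where
  "sigma_X d P = vimage_algebra (space P) fst (Rd d)"

text \<open>
  As \<open>E[Y^2 | X = x]\<close> is determined only up to null sets of the law of \<open>X\<close>, its supremum
  over \<open>x\<close> is the essential one. The conditional expectation is the nonnegative extended one:
  \<^const>\<open>real_cond_exp\<close> would map an infinite conditional second moment to \<open>0\<close>.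
\<close>

definition cond_second_moment_le ::
  "nat \<Rightarrow> real \<Rightarrow> ((nat \<Rightarrow> real) \<times> real) measure \<Rightarrow> bool" where
  "cond_second_moment_le d m P \<longleftrightarrow>
     (AE z in P. nn_cond_exp P (sigma_X d P) (\<lambda>(x, y). ennreal (y\<^sup>2)) z \<le> ennreal (m\<^sup>2))"

text \<open>
  \<^const>\<open>nn_cond_exp\<close> is \<open>0\<close> by convention for a non-measurable argument or a second argument that
  is not a subalgebra; neither case occurs here.
\<close>

lemma sigma_finite_subalgebra_sigma_X:
  assumes "data_distribution d P"
  shows "sigma_finite_subalgebra P (sigma_X d P)"
proof -
  have P: "prob_space P" and S: "sets P = sets (data_space d)"
    using assms by (auto simp: data_distribution_def)
  have fst: "fst \<in> P \<rightarrow>\<^sub>M Rd d"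
    using S by (simp cong: measurable_cong_sets)
  have "subalgebra P (sigma_X d P)"
    unfolding subalgebra_def sigma_X_def
    using fst by (auto simp: sets_vimage_algebra2 measurable_space measurable_sets)
  then have "finite_measure_subalgebra P (sigma_X d P)"
    using P by (simp add: finite_measure_subalgebra_def finite_measure_subalgebra_axioms_def
        prob_space.finite_measure)
  then show ?thesis
    by (rule finite_measure_subalgebra_is_sigma_finite)
qed

lemma borel_measurable_squared_response:
  assumes "data_distribution d P"
  shows "(\<lambda>(x, y). ennreal (y\<^sup>2)) \<in> borel_measurable P"
proof -
  have "sets P = sets (data_space d)"
    using assms by (simp add: data_distribution_def)
  then show ?thesis
    by (simp cong: measurable_cong_sets)
qed

end

theory Submission
  imports Defs
begin

text \<open>
  Truncating the class to \<open>[- m, m]\<close> does not increase any risk, since \<open>E[Y^2 | X] \<le> m^2\<close>. For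
  truncated \<open>f\<close>, \<open>g\<close>, both the loss difference and \<open>(f - g)^2\<close> have second moment at most
  \<open>16 m^2 E(f - g)^2\<close>, so a Catoni-type mean estimator at a fixed scale of order \<open>m^(-2)\<close> recovers
  \<open>R(f) - R(g)\<close> and \<open>E(f - g)^2\<close> up to a small multiple of \<open>E(f - g)^2\<close> plus
  \<open>\<Lambda> = O(m^2 log(|F| / \<delta>) / n)\<close>, simultaneously for all pairs. The functions not significantly beaten
  by any other include the minimizer of the risk. The output is the midpoint of one of them and the
  one estimated to be farthest from it: by the parallelogram identity the midpoint gains
  \<open>E(f - g)^2 / 4\<close>, which absorbs all errors proportional to squared distances.
\<close>

section \<open>Catoni-type mean estimation under a second moment bound\<close>

lemma catoni_weight_pos: "1 + x + x\<^sup>2 / 2 > (0::real)"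
proof -
  have "1 + x + x\<^sup>2 / 2 = ((1 + x)\<^sup>2 + 1) / 2"
    by (simp add: power2_eq_square field_simps)
  then show ?thesis
    by (smt (verit) divide_pos_pos zero_le_power2)
qed

text \<open>
  This inequality makes one and the same logarithmic influence function control both tails.
\<close>

lemma neg_ln_catoni_weight_le:
  "- ln (1 + x + x\<^sup>2 / 2) \<le> ln (1 - x + x\<^sup>2 / (2::real))"
proof -
  have pos: "1 + x + x\<^sup>2 / 2 > 0" "1 - x + x\<^sup>2 / 2 > 0"
    using catoni_weight_pos[of x] catoni_weight_pos[of "- x"] by simp_all
  have "(1 + x + x\<^sup>2 / 2) * (1 - x + x\<^sup>2 / 2) = 1 + x ^ 4 / 4"
    by (simp add: power2_eq_square power4_eq_xxxx field_simps)
  then have "0 \<le> ln ((1 + x + x\<^sup>2 / 2) * (1 - x + x\<^sup>2 / 2))"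
    by simp
  also have "\<dots> = ln (1 + x + x\<^sup>2 / 2) + ln (1 - x + x\<^sup>2 / 2)"
    using pos by (simp add: ln_mult_pos)
  finally show ?thesis by simp
qed

text \<open>A closed form centred at 0, instead of Catoni's root of an equation in the location
  parameter. The price is that deviations scale with the raw second moment rather than the variance;
  the moment bounds proved later are of that kind.\<close>

definition catoni_mean :: "real \<Rightarrow> nat \<Rightarrow> ('a \<Rightarrow> real) \<Rightarrow> (nat \<Rightarrow> 'a) \<Rightarrow> real" where
  "catoni_mean \<alpha> n Z s = (\<Sum>i<n. ln (1 + \<alpha> * Z (s i) + (\<alpha> * Z (s i))\<^sup>2 / 2)) / (real n * \<alpha>)"

text \<open>Turns a lower deviation for \<open>Z\<close> into an upper deviation for
  \<open>- Z\<close>, so that one exponential moment bound covers both tails.\<close>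

lemma catoni_mean_uminus:
  assumes "\<alpha> > 0"
  shows "- catoni_mean \<alpha> n Z s \<le> catoni_mean \<alpha> n (\<lambda>z. - Z z) s"
proof -
  have "- (\<Sum>i<n. ln (1 + \<alpha> * Z (s i) + (\<alpha> * Z (s i))\<^sup>2 / 2))
      \<le> (\<Sum>i<n. ln (1 + \<alpha> * - Z (s i) + (\<alpha> * - Z (s i))\<^sup>2 / 2))"
    unfolding sum_negf[symmetric]
    by (rule sum_mono) (use neg_ln_catoni_weight_le in simp)
  then show ?thesis
    unfolding catoni_mean_def minus_divide_left using assms
    by (intro divide_right_mono) auto
qed

lemma measurable_catoni_mean [measurable]:
  assumes [measurable]: "Z \<in> borel_measurable M"
  shows "catoni_mean \<alpha> n Z \<in> borel_measurable (PiM {..<n} (\<lambda>_. M))"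
proof -
  have [measurable]: "(\<lambda>s. Z (s i)) \<in> borel_measurable (PiM {..<n} (\<lambda>_. M))" if "i \<in> {..<n}" for i
    by (rule measurable_compose[OF measurable_component_singleton[OF that]]) measurable
  show ?thesis
    unfolding catoni_mean_def by measurable
qed

text \<open>A Chernoff bound from two moments: the exponential of n \<alpha> times the estimator is
  a product of independent weights \<open>w\<close>, each of mean 1 + b \<le> exp b, so the product
  has mean at most exp (n b). Markov's inequality at level exp (n b + L) gives the tail.\<close>

lemma (in prob_space) catoni_mean_upper_tail:
  fixes Z :: "'a \<Rightarrow> real"
  assumes Z: "integrable M Z" "integrable M (\<lambda>z. (Z z)\<^sup>2)" and \<alpha>: "\<alpha> > 0" and n: "n \<ge> 1"
  shows "measure (PiM {..<n} (\<lambda>_. M))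
      {s \<in> space (PiM {..<n} (\<lambda>_. M)). catoni_mean \<alpha> n Z s
         > expectation Z + \<alpha> / 2 * expectation (\<lambda>z. (Z z)\<^sup>2) + L / (real n * \<alpha>)} \<le> exp (- L)"
    (is "measure ?N ?E \<le> _")
proof -
  interpret N: product_prob_space "\<lambda>_. M" "{..<n}" by unfold_locales
  have [measurable]: "Z \<in> borel_measurable M" using Z by auto
  define w where "w z = 1 + \<alpha> * Z z + (\<alpha> * Z z)\<^sup>2 / 2" for z
  define b where "b = \<alpha> * expectation Z + \<alpha>\<^sup>2 / 2 * expectation (\<lambda>z. (Z z)\<^sup>2)"
  have [measurable]: "w \<in> borel_measurable M" unfolding w_def by measurable
  have w_pos: "w z > 0" for z unfolding w_def by (rule catoni_weight_pos)
  have w_int: "integrable M w"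
    unfolding w_def power_mult_distrib using Z by simp
  have "expectation w = 1 + b"
    unfolding w_def b_def power_mult_distrib using Z by (simp add: prob_space)
  then have "(\<integral>\<^sup>+z. ennreal (w z) \<partial>M) = ennreal (1 + b)"
    using w_int w_pos by (subst nn_integral_eq_integral) (auto simp: less_imp_le)
  also have "\<dots> \<le> ennreal (exp b)"
    by (rule ennreal_leI) (rule exp_ge_add_one_self)
  finally have w_exp: "(\<integral>\<^sup>+z. ennreal (w z) \<partial>M) \<le> ennreal (exp b)" .
  have "(\<integral>\<^sup>+s. (\<Prod>i<n. ennreal (w (s i))) \<partial>?N) = (\<Prod>i<n. \<integral>\<^sup>+z. ennreal (w z) \<partial>M)"
    by (rule N.product_nn_integral_prod) auto
  also have "\<dots> \<le> (\<Prod>i<n. ennreal (exp b))"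
    using w_exp by (simp add: power_mono)
  also have "\<dots> = ennreal (exp (real n * b))"
    by (simp add: ennreal_power exp_of_nat_mult)
  finally have prod_le: "(\<integral>\<^sup>+s. (\<Prod>i<n. ennreal (w (s i))) \<partial>?N) \<le> ennreal (exp (real n * b))" .
  have [measurable]: "(\<lambda>s. w (s i)) \<in> borel_measurable ?N" if "i \<in> {..<n}" for i
    by (rule measurable_compose[OF measurable_component_singleton[OF that]]) measurable
  have [measurable]: "(\<lambda>s. \<Prod>i<n. ennreal (w (s i))) \<in> borel_measurable ?N"
    by measurable
  have "?E \<subseteq> {s \<in> space ?N. ennreal (exp (- real n * b - L)) * (\<Prod>i<n. ennreal (w (s i))) \<ge> 1}"
  proof safe
    fix s assume "catoni_mean \<alpha> n Z s
         > expectation Z + \<alpha> / 2 * expectation (\<lambda>z. (Z z)\<^sup>2) + L / (real n * \<alpha>)"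
    then have "(\<Sum>i<n. ln (w (s i))) / (real n * \<alpha>) > (real n * b + L) / (real n * \<alpha>)"
      using \<alpha> n unfolding catoni_mean_def b_def w_def
      by (simp add: add_divide_distrib power2_eq_square distrib_left)
    then have "(\<Sum>i<n. ln (w (s i))) > real n * b + L"
      using \<alpha> n by (simp add: divide_less_cancel)
    then have "1 \<le> exp (- real n * b - L) * exp (\<Sum>i<n. ln (w (s i)))"
      by (simp flip: exp_add)
    also have "exp (\<Sum>i<n. ln (w (s i))) = (\<Prod>i<n. w (s i))"
      by (simp add: exp_sum w_pos)
    finally have "ennreal 1 \<le> ennreal (exp (- real n * b - L) * (\<Prod>i<n. w (s i)))"
      by (rule ennreal_leI)
    also have "\<dots> = ennreal (exp (- real n * b - L)) * (\<Prod>i<n. ennreal (w (s i)))"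
      by (simp add: ennreal_mult prod_ennreal prod_nonneg w_pos less_imp_le)
    finally show "1 \<le> ennreal (exp (- real n * b - L)) * (\<Prod>i<n. ennreal (w (s i)))"
      by simp
  qed
  then have "emeasure ?N ?E
      \<le> emeasure ?N ({s \<in> space ?N. ennreal (exp (- real n * b - L)) * (\<Prod>i<n. ennreal (w (s i))) \<ge> 1})"
    by (intro emeasure_mono) auto
  also have "\<dots> \<le> ennreal (exp (- real n * b - L))
      * (\<integral>\<^sup>+s. (\<Prod>i<n. ennreal (w (s i))) * indicator (space ?N) s \<partial>?N)"
    by (rule nn_integral_Markov_inequality) measurable
  also have "\<dots> = ennreal (exp (- real n * b - L)) * (\<integral>\<^sup>+s. (\<Prod>i<n. ennreal (w (s i))) \<partial>?N)"
    by (intro arg_cong2[where f="(*)"] refl nn_integral_cong) auto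
  also have "\<dots> \<le> ennreal (exp (- real n * b - L)) * ennreal (exp (real n * b))"
    by (intro mult_left_mono prod_le) auto
  also have "\<dots> = ennreal (exp (- L))"
    by (simp flip: ennreal_mult exp_add)
  finally show ?thesis
    by (simp add: N.emeasure_eq_measure)
qed

text \<open>The failure event is covered by the upper tails for \<open>Z\<close> and
  \<open>- Z\<close>, which share their second moment. It is phrased as a failure because it enters
  a union bound.\<close>

lemma (in prob_space) catoni_mean_deviation:
  fixes Z :: "'a \<Rightarrow> real"
  assumes Z: "integrable M Z" "integrable M (\<lambda>z. (Z z)\<^sup>2)" and \<alpha>: "\<alpha> > 0" and n: "n \<ge> 1"
    and v: "expectation (\<lambda>z. (Z z)\<^sup>2) \<le> v"
  shows "measure (PiM {..<n} (\<lambda>_. M))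
      {s \<in> space (PiM {..<n} (\<lambda>_. M)). \<not> \<bar>catoni_mean \<alpha> n Z s - expectation Z\<bar>
         \<le> \<alpha> / 2 * v + L / (real n * \<alpha>)} \<le> 2 * exp (- L)"
    (is "measure ?N ?E \<le> _")
proof -
  interpret N: product_prob_space "\<lambda>_. M" "{..<n}" by unfold_locales
  have [measurable]: "Z \<in> borel_measurable M" using Z by auto
  define E where "E W = {s \<in> space ?N. catoni_mean \<alpha> n W s
         > expectation W + \<alpha> / 2 * expectation (\<lambda>z. (W z)\<^sup>2) + L / (real n * \<alpha>)}" for W
  have E_sets: "E W \<in> sets ?N" if [measurable]: "W \<in> borel_measurable M" for W
    unfolding E_def by measurable
  have "?E \<subseteq> E Z \<union> E (\<lambda>z. - Z z)"
  proof
    fix s assume s: "s \<in> ?E"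
    have "\<alpha> / 2 * expectation (\<lambda>z. (Z z)\<^sup>2) \<le> \<alpha> / 2 * v"
      using \<alpha> v by (intro mult_left_mono) auto
    with s catoni_mean_uminus[OF \<alpha>, of n Z s] show "s \<in> E Z \<union> E (\<lambda>z. - Z z)"
      unfolding E_def by (auto simp: abs_le_iff)
  qed
  then have "measure ?N ?E \<le> measure ?N (E Z \<union> E (\<lambda>z. - Z z))"
    by (intro N.finite_measure_mono) (auto intro!: sets.Un E_sets)
  also have "\<dots> \<le> measure ?N (E Z) + measure ?N (E (\<lambda>z. - Z z))"
    by (intro measure_Un_le E_sets) auto
  also have "\<dots> \<le> exp (- L) + exp (- L)"
    unfolding E_def by (intro add_mono catoni_mean_upper_tail) (use Z \<alpha> n in auto)
  finally show ?thesis by simp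
qed

section \<open>Measurable choice from a finite set\<close>

text \<open>Takes the first suitable candidate along an enumeration of \<open>H\<close>. The
  guarantee is conditional since on some samples no candidate may satisfy \<open>C\<close>, while
  the selector must be total for the estimator to be defined everywhere.\<close>

lemma finite_measurable_selection:
  assumes "finite H" "H \<noteq> {}" and "\<And>h. h \<in> H \<Longrightarrow> {s \<in> space S. C h s} \<in> sets S"
  shows "\<exists>sel \<in> S \<rightarrow>\<^sub>M count_space H. (\<forall>s. sel s \<in> H) \<and> (\<forall>s. \<forall>h\<in>H. C h s \<longrightarrow> C (sel s) s)"
  using assms
proof (induction H rule: finite_ne_induct)
  case (singleton a)
  then show ?case by (intro bexI[of _ "\<lambda>_. a"]) auto
next
  case (insert a H)
  then obtain sel where sel: "sel \<in> S \<rightarrow>\<^sub>M count_space H" "\<And>s. sel s \<in> H"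
      "\<And>s h. h \<in> H \<Longrightarrow> C h s \<Longrightarrow> C (sel s) s"
    by (metis insert_iff)
  have "sel \<in> S \<rightarrow>\<^sub>M count_space (insert a H)"
    by (rule measurable_compose[OF sel(1)]) auto
  then have "(\<lambda>s. if C a s then a else sel s) \<in> S \<rightarrow>\<^sub>M count_space (insert a H)"
    using insert.prems by (intro measurable_If) auto
  with sel show ?case
    by (intro bexI[of _ "\<lambda>s. if C a s then a else sel s"]) auto
qed

section \<open>Clipped predictors, loss differences and squared distances\<close>

definition clip :: "real \<Rightarrow> ('a \<Rightarrow> real) \<Rightarrow> 'a \<Rightarrow> real" where
  "clip m f x = max (- m) (min m (f x))"

text \<open>Extensionality is not imposed, because clipping may change the default value outside
  R^d; it is restored in the final output. The bound holds at every argument, so that it can be used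
  pointwise without a membership side condition.\<close>

definition bounded_predictors :: "nat \<Rightarrow> real \<Rightarrow> ((nat \<Rightarrow> real) \<Rightarrow> real) set" where
  "bounded_predictors d m = {f \<in> borel_measurable (Rd d). \<forall>x. \<bar>f x\<bar> \<le> m}"

lemma bounded_predictorsD [dest]:
  assumes "f \<in> bounded_predictors d m"
  shows "f \<in> borel_measurable (Rd d)" "\<And>x. \<bar>f x\<bar> \<le> m"
  using assms by (auto simp: bounded_predictors_def)

lemma clip_bounded_predictors:
  assumes [measurable]: "f \<in> borel_measurable (Rd d)" and "m \<ge> 0"
  shows "clip m f \<in> bounded_predictors d m"
  unfolding bounded_predictors_def clip_def[abs_def] using assms(2) by (auto simp: abs_le_iff)

definition excess_loss :: "('a \<Rightarrow> real) \<Rightarrow> ('a \<Rightarrow> real) \<Rightarrow> 'a \<times> real \<Rightarrow> real" where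
  "excess_loss f g z = (f (fst z) - snd z)\<^sup>2 - (g (fst z) - snd z)\<^sup>2"

text \<open>A function of the whole data point, so that the same mean estimator on the same sample
  applies to it as to the losses.\<close>

definition sq_diff :: "('a \<Rightarrow> real) \<Rightarrow> ('a \<Rightarrow> real) \<Rightarrow> 'a \<times> real \<Rightarrow> real" where
  "sq_diff f g z = (f (fst z) - g (fst z))\<^sup>2"

text \<open>Y^2 cancels, leaving an expression linear in Y with the factor f - g. Hence the second
  moment involves only Y^2 and is proportional to the squared distance.\<close>

lemma excess_loss_eq: "excess_loss f g z = (f (fst z) - g (fst z)) * (f (fst z) + g (fst z) - 2 * snd z)"
  unfolding excess_loss_def by (simp add: power2_eq_square algebra_simps)

lemma measurable_excess_loss:
  assumes [measurable]: "f \<in> borel_measurable M" "g \<in> borel_measurable M"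
  shows "excess_loss f g \<in> borel_measurable (M \<Otimes>\<^sub>M borel)"
  unfolding excess_loss_def[abs_def] by measurable

lemma measurable_sq_diff:
  assumes [measurable]: "f \<in> borel_measurable M" "g \<in> borel_measurable M"
  shows "sq_diff f g \<in> borel_measurable (M \<Otimes>\<^sub>M borel)"
  unfolding sq_diff_def[abs_def] by measurable

section \<open>Moments and risks under the conditional second moment bound\<close>

locale regression_model =
  fixes d :: nat and m :: real and P :: "((nat \<Rightarrow> real) \<times> real) measure"
  assumes distr: "data_distribution d P" and moment: "cond_second_moment_le d m P" and m_pos: "m > 0"

sublocale regression_model \<subseteq> prob_space P
  using distr by (simp add: data_distribution_def)

context regression_model
begin

lemma sets_P [measurable_cong]: "sets P = sets (Rd d \<Otimes>\<^sub>M borel)"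
  using distr by (simp add: data_distribution_def)

lemma fst_in_space: "z \<in> space P \<Longrightarrow> fst z \<in> space (Rd d)"
  using sets_eq_imp_space_eq[OF sets_P] by (auto simp: space_pair_measure)

text \<open>The form in which the conditional moment assumption is used: against a weight depending
  on X alone, Y^2 may be replaced by m^2. With extended nonnegative integrals it applies before the
  weight is known to be integrable.\<close>

lemma nn_integral_mult_response_le:
  assumes [measurable]: "\<phi> \<in> borel_measurable (Rd d)"
  shows "(\<integral>\<^sup>+z. \<phi> (fst z) * ennreal ((snd z)\<^sup>2) \<partial>P) \<le> ennreal (m\<^sup>2) * (\<integral>\<^sup>+z. \<phi> (fst z) \<partial>P)"
proof -
  interpret sigma_finite_subalgebra P "sigma_X d P"
    by (rule sigma_finite_subalgebra_sigma_X[OF distr])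
  have fst: "fst \<in> sigma_X d P \<rightarrow>\<^sub>M Rd d"
    unfolding sigma_X_def by (rule measurable_vimage_algebra1) (use fst_in_space in auto)
  let ?Y = "\<lambda>(x, y). ennreal (y\<^sup>2)"
  have "(\<integral>\<^sup>+z. \<phi> (fst z) * ennreal ((snd z)\<^sup>2) \<partial>P) = (\<integral>\<^sup>+z. \<phi> (fst z) * ?Y z \<partial>P)"
    by (simp add: case_prod_beta')
  also have "\<dots> = (\<integral>\<^sup>+z. \<phi> (fst z) * nn_cond_exp P (sigma_X d P) ?Y z \<partial>P)"
    by (rule nn_cond_exp_intg[symmetric])
      (use measurable_compose[OF fst assms] borel_measurable_squared_response[OF distr] in auto)
  also have "\<dots> \<le> (\<integral>\<^sup>+z. \<phi> (fst z) * ennreal (m\<^sup>2) \<partial>P)"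
  proof (rule nn_integral_mono_AE)
    show "AE z in P. \<phi> (fst z) * nn_cond_exp P (sigma_X d P) ?Y z \<le> \<phi> (fst z) * ennreal (m\<^sup>2)"
      using moment unfolding cond_second_moment_le_def by eventually_elim (rule mult_left_mono, auto)
  qed
  also have "\<dots> = ennreal (m\<^sup>2) * (\<integral>\<^sup>+z. \<phi> (fst z) \<partial>P)"
    by (simp add: nn_integral_multc mult.commute)
  finally show ?thesis .
qed

lemma integrable_response_sq: "integrable P (\<lambda>z. (snd z)\<^sup>2)"
proof (rule integrableI_nonneg)
  have "(\<integral>\<^sup>+z. ennreal ((snd z)\<^sup>2) \<partial>P) \<le> ennreal (m\<^sup>2)"
    using nn_integral_mult_response_le[of "\<lambda>_. 1"] by (simp add: emeasure_space_1)
  then show "(\<integral>\<^sup>+z. ennreal ((snd z)\<^sup>2) \<partial>P) < \<infinity>"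
    by (simp add: order.strict_trans1)
qed auto

lemma integrable_response: "integrable P snd"
  by (rule square_integrable_imp_integrable) (auto simp: integrable_response_sq)

lemma integrable_mult_bounded:
  fixes \<phi> :: "(nat \<Rightarrow> real) \<Rightarrow> real" and W :: "(nat \<Rightarrow> real) \<times> real \<Rightarrow> real"
  assumes [measurable]: "\<phi> \<in> borel_measurable (Rd d)" and \<phi>: "\<And>x. \<bar>\<phi> x\<bar> \<le> C"
    and W: "integrable P W"
  shows "integrable P (\<lambda>z. \<phi> (fst z) * W z)"
proof (rule Bochner_Integration.integrable_bound)
  show "integrable P (\<lambda>z. C * W z)" using W by simp
  show "(\<lambda>z. \<phi> (fst z) * W z) \<in> borel_measurable P" using W by measurable
  have "\<bar>\<phi> x\<bar> * \<bar>W z\<bar> \<le> \<bar>C\<bar> * \<bar>W z\<bar>" for x z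
    using \<phi>[of x] by (intro mult_right_mono) auto
  then show "AE z in P. norm (\<phi> (fst z) * W z) \<le> norm (C * W z)"
    by (simp add: abs_mult)
qed

lemma integrable_bounded:
  fixes \<phi> :: "(nat \<Rightarrow> real) \<Rightarrow> real"
  assumes "\<phi> \<in> borel_measurable (Rd d)" "\<And>x. \<bar>\<phi> x\<bar> \<le> C"
  shows "integrable P (\<lambda>z. \<phi> (fst z))"
  using integrable_mult_bounded[OF assms, of "\<lambda>_. 1"] by simp

lemma expectation_mult_response_le:
  fixes \<phi> :: "(nat \<Rightarrow> real) \<Rightarrow> real"
  assumes [measurable]: "\<phi> \<in> borel_measurable (Rd d)" and \<phi>: "\<And>x. \<bar>\<phi> x\<bar> \<le> C" "\<And>x. 0 \<le> \<phi> x"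
  shows "expectation (\<lambda>z. \<phi> (fst z) * (snd z)\<^sup>2) \<le> m\<^sup>2 * expectation (\<lambda>z. \<phi> (fst z))"
proof -
  note int = integrable_mult_bounded[OF assms(1,2) integrable_response_sq] integrable_bounded[OF assms(1,2)]
  have "ennreal (expectation (\<lambda>z. \<phi> (fst z) * (snd z)\<^sup>2)) = (\<integral>\<^sup>+z. ennreal (\<phi> (fst z) * (snd z)\<^sup>2) \<partial>P)"
    using int \<phi> by (intro nn_integral_eq_integral[symmetric]) auto
  also have "\<dots> = (\<integral>\<^sup>+z. ennreal (\<phi> (fst z)) * ennreal ((snd z)\<^sup>2) \<partial>P)"
    using \<phi> by (simp add: ennreal_mult)
  also have "\<dots> \<le> ennreal (m\<^sup>2) * (\<integral>\<^sup>+z. ennreal (\<phi> (fst z)) \<partial>P)"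
    by (rule nn_integral_mult_response_le) measurable
  also have "(\<integral>\<^sup>+z. ennreal (\<phi> (fst z)) \<partial>P) = ennreal (expectation (\<lambda>z. \<phi> (fst z)))"
    using int \<phi> by (intro nn_integral_eq_integral) auto
  finally show ?thesis
    using \<phi> by (simp flip: ennreal_mult)
qed


text \<open>A real-valued risk for arithmetic. It agrees with \<open>risk P f\<close> for bounded
  predictors, whose loss is integrable; a non-integrable loss would give the default value
  0.\<close>

definition sq_risk :: "((nat \<Rightarrow> real) \<Rightarrow> real) \<Rightarrow> real" where
  "sq_risk f = expectation (\<lambda>z. (f (fst z) - snd z)\<^sup>2)"

abbreviation "sq_dist f g \<equiv> expectation (sq_diff f g)"

lemma integrable_sq_loss:
  assumes f: "f \<in> bounded_predictors d m"
  shows "integrable P (\<lambda>z. (f (fst z) - snd z)\<^sup>2)"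
proof -
  have [measurable]: "f \<in> borel_measurable (Rd d)" using f by auto
  have "(f x)\<^sup>2 \<le> m\<^sup>2" for x
    using f m_pos by (auto simp: bounded_predictors_def intro!: abs_le_square_iff[THEN iffD1])
  then have "integrable P (\<lambda>z. (f (fst z))\<^sup>2)"
    by (intro integrable_bounded[of "\<lambda>x. (f x)\<^sup>2" "m\<^sup>2"]) auto
  moreover have "integrable P (\<lambda>z. f (fst z) * snd z)"
    using f by (intro integrable_mult_bounded[where C=m] integrable_response) auto
  ultimately have "integrable P (\<lambda>z. (f (fst z))\<^sup>2 + (snd z)\<^sup>2 - 2 * (f (fst z) * snd z))"
    by (simp add: integrable_response_sq)
  then show ?thesis by (simp add: power2_diff mult.assoc)
qed

lemma risk_eq_sq_risk:
  assumes "f \<in> bounded_predictors d m"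
  shows "risk P f = ereal (sq_risk f)"
  using integrable_sq_loss[OF assms] unfolding risk_def sq_risk_def
  by (simp add: case_prod_beta' nn_integral_eq_integral enn2ereal_ennreal)

lemma bounded_predictors_diff:
  assumes "f \<in> bounded_predictors d m" "g \<in> bounded_predictors d m"
  shows "(\<lambda>x. (f x - g x)\<^sup>2) \<in> borel_measurable (Rd d)" "(f x - g x)\<^sup>2 \<le> 4 * m\<^sup>2"
    "(f x + g x)\<^sup>2 \<le> 4 * m\<^sup>2"
proof -
  have [measurable]: "f \<in> borel_measurable (Rd d)" "g \<in> borel_measurable (Rd d)" using assms by auto
  show "(\<lambda>x. (f x - g x)\<^sup>2) \<in> borel_measurable (Rd d)" by measurable
  have "\<bar>f x\<bar> \<le> m" "\<bar>g x\<bar> \<le> m" using assms by auto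
  then have "\<bar>f x - g x\<bar> \<le> \<bar>2 * m\<bar>" "\<bar>f x + g x\<bar> \<le> \<bar>2 * m\<bar>" by auto
  then show "(f x - g x)\<^sup>2 \<le> 4 * m\<^sup>2" "(f x + g x)\<^sup>2 \<le> 4 * m\<^sup>2"
    by (simp_all add: abs_le_square_iff power_mult_distrib)
qed

lemma integrable_sq_diff:
  assumes "f \<in> bounded_predictors d m" "g \<in> bounded_predictors d m"
  shows "integrable P (sq_diff f g)"
  unfolding sq_diff_def[abs_def]
  using bounded_predictors_diff[OF assms]
  by (intro integrable_bounded[of "\<lambda>x. (f x - g x)\<^sup>2" "4 * m\<^sup>2"]) auto

lemma sq_diff_second_moment:
  assumes "f \<in> bounded_predictors d m" "g \<in> bounded_predictors d m"
  shows "integrable P (\<lambda>z. (sq_diff f g z)\<^sup>2)"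
    "expectation (\<lambda>z. (sq_diff f g z)\<^sup>2) \<le> 16 * m\<^sup>2 * sq_dist f g"
proof -
  note [measurable] = bounded_predictors_diff(1)[OF assms]
  have bd: "\<bar>(f x - g x)\<^sup>2\<bar> \<le> 4 * m\<^sup>2" for x
    using bounded_predictors_diff(2)[OF assms] by simp
  have "integrable P (\<lambda>z. (f (fst z) - g (fst z))\<^sup>2 * sq_diff f g z)"
    by (intro integrable_mult_bounded[of "\<lambda>x. (f x - g x)\<^sup>2" "4 * m\<^sup>2"] bd
        integrable_sq_diff[OF assms]) measurable
  then show *: "integrable P (\<lambda>z. (sq_diff f g z)\<^sup>2)"
    by (simp add: sq_diff_def power2_eq_square)
  \<comment> \<open>The factor 16 matches the bound for \<open>excess_loss\<close>, so that one
    scale \<alpha> serves both estimates.\<close>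
  have "(sq_diff f g z)\<^sup>2 \<le> 16 * m\<^sup>2 * sq_diff f g z" for z
    unfolding power2_eq_square[of "sq_diff f g z"]
  proof (rule mult_right_mono)
    show "sq_diff f g z \<le> 16 * m\<^sup>2"
      using bd[of "fst z"] zero_le_power2[of m] unfolding sq_diff_def by linarith
  qed (simp add: sq_diff_def)
  then have "expectation (\<lambda>z. (sq_diff f g z)\<^sup>2) \<le> expectation (\<lambda>z. 16 * m\<^sup>2 * sq_diff f g z)"
    by (intro integral_mono * integrable_mult_right integrable_sq_diff assms)
  then show "expectation (\<lambda>z. (sq_diff f g z)\<^sup>2) \<le> 16 * m\<^sup>2 * sq_dist f g"
    by simp
qed

lemma excess_loss_mean:
  assumes "f \<in> bounded_predictors d m" "g \<in> bounded_predictors d m"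
  shows "integrable P (excess_loss f g)" "expectation (excess_loss f g) = sq_risk f - sq_risk g"
  unfolding excess_loss_def[abs_def] sq_risk_def
  using assms by (auto intro!: integrable_sq_loss Bochner_Integration.integral_diff)

text \<open>From (f + g - 2 Y)^2 \<le> 2 (f + g)^2 + 8 Y^2 \<le> 8 m^2 + 8 Y^2. The remaining factor
  (f - g)^2 depends on X only, so the conditional moment bound turns 8 Y^2 into another 8
  m^2.\<close>

lemma excess_loss_second_moment:
  assumes "f \<in> bounded_predictors d m" "g \<in> bounded_predictors d m"
  shows "integrable P (\<lambda>z. (excess_loss f g z)\<^sup>2)"
    "expectation (\<lambda>z. (excess_loss f g z)\<^sup>2) \<le> 16 * m\<^sup>2 * sq_dist f g"
proof -
  have [measurable]: "f \<in> borel_measurable (Rd d)" "g \<in> borel_measurable (Rd d)" using assms by auto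
  have bd: "\<bar>(f x - g x)\<^sup>2\<bar> \<le> 4 * m\<^sup>2" for x
    using bounded_predictors_diff(2)[OF assms] by simp
  define B where "B z = 8 * m\<^sup>2 * sq_diff f g z + 8 * ((f (fst z) - g (fst z))\<^sup>2 * (snd z)\<^sup>2)" for z
  have int: "integrable P (\<lambda>z. (f (fst z) - g (fst z))\<^sup>2 * (snd z)\<^sup>2)"
    by (intro integrable_mult_bounded[of "\<lambda>x. (f x - g x)\<^sup>2" "4 * m\<^sup>2"] bd integrable_response_sq)
      measurable
  have B_int: "integrable P B"
    unfolding B_def using int by (simp add: integrable_sq_diff assms)
  have le: "(excess_loss f g z)\<^sup>2 \<le> B z" for z
  proof -
    let ?x = "fst z" and ?y = "snd z"
    have "(f ?x + g ?x - 2 * ?y)\<^sup>2 \<le> 2 * (f ?x + g ?x)\<^sup>2 + 8 * ?y\<^sup>2"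
      using zero_le_power2[of "f ?x + g ?x + 2 * ?y"] by (simp add: power2_eq_square algebra_simps)
    also have "\<dots> \<le> 8 * m\<^sup>2 + 8 * ?y\<^sup>2"
      using bounded_predictors_diff(3)[OF assms, of ?x] by simp
    finally have "(excess_loss f g z)\<^sup>2 \<le> sq_diff f g z * (8 * m\<^sup>2 + 8 * ?y\<^sup>2)"
      unfolding excess_loss_eq power_mult_distrib sq_diff_def by (intro mult_left_mono) auto
    then show ?thesis by (simp add: B_def sq_diff_def algebra_simps)
  qed
  have [measurable]: "excess_loss f g \<in> borel_measurable P"
    using excess_loss_mean(1)[OF assms] by auto
  show *: "integrable P (\<lambda>z. (excess_loss f g z)\<^sup>2)"
  proof (rule Bochner_Integration.integrable_bound[OF B_int])
    show "AE z in P. norm ((excess_loss f g z)\<^sup>2) \<le> norm (B z)"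
      by (rule AE_I2) (simp add: order.trans[OF le abs_ge_self])
  qed measurable
  have "expectation (\<lambda>z. (excess_loss f g z)\<^sup>2) \<le> expectation B"
    by (intro integral_mono * B_int le)
  also have "\<dots> = 8 * m\<^sup>2 * sq_dist f g
      + 8 * expectation (\<lambda>z. (f (fst z) - g (fst z))\<^sup>2 * (snd z)\<^sup>2)"
    unfolding B_def using int by (simp add: integrable_sq_diff assms)
  also have "expectation (\<lambda>z. (f (fst z) - g (fst z))\<^sup>2 * (snd z)\<^sup>2) \<le> m\<^sup>2 * sq_dist f g"
    unfolding sq_diff_def[abs_def]
    by (rule expectation_mult_response_le[of "\<lambda>x. (f x - g x)\<^sup>2", OF _ bd]) auto
  finally show "expectation (\<lambda>z. (excess_loss f g z)\<^sup>2) \<le> 16 * m\<^sup>2 * sq_dist f g"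
    by (simp add: mult_ac)
qed

lemma sq_dist_triangle:
  assumes "f \<in> bounded_predictors d m" "g \<in> bounded_predictors d m" "h \<in> bounded_predictors d m"
  shows "sq_dist g h \<le> 2 * sq_dist f g + 2 * sq_dist f h"
proof -
  have "(b - c)\<^sup>2 \<le> 2 * (a - b)\<^sup>2 + 2 * (a - c)\<^sup>2" for a b c :: real
    using zero_le_power2[of "(a - b) + (a - c)"] by (simp add: power2_eq_square algebra_simps)
  then have "sq_diff g h z \<le> 2 * sq_diff f g z + 2 * sq_diff f h z" for z
    by (simp add: sq_diff_def)
  then have "sq_dist g h \<le> expectation (\<lambda>z. 2 * sq_diff f g z + 2 * sq_diff f h z)"
    using assms by (intro integral_mono) (simp_all add: integrable_sq_diff)
  then show ?thesis
    using assms by (simp add: integrable_sq_diff)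
qed

text \<open>The parallelogram identity for f(X) - Y and g(X) - Y, whose difference is free of
  Y.\<close>

lemma sq_risk_midpoint:
  assumes "f \<in> bounded_predictors d m" "g \<in> bounded_predictors d m"
  shows "sq_risk (\<lambda>x. (f x + g x) / 2) = (sq_risk f + sq_risk g) / 2 - sq_dist f g / 4"
proof -
  have "((a + b) / 2 - y)\<^sup>2 = ((a - y)\<^sup>2 + (b - y)\<^sup>2) / 2 - (a - b)\<^sup>2 / 4" for a b y :: real
    by (simp add: power2_eq_square field_simps)
  then show ?thesis
    unfolding sq_risk_def using assms
    by (simp add: integrable_sq_diff integrable_sq_loss flip: sq_diff_def)
qed

text \<open>Clipping can increase the loss pointwise, since Y is unbounded. The possible increase is
  dominated by \<phi>(X) (Y^2 - m^2) with \<phi> \<ge> 0, whose integral is at most 0 by the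
  conditional moment bound.\<close>

lemma risk_clip_le:
  assumes [measurable]: "f \<in> borel_measurable (Rd d)"
  shows "risk P (clip m f) \<le> risk P f"
proof (cases "(\<integral>\<^sup>+z. ennreal ((f (fst z) - snd z)\<^sup>2) \<partial>P) = \<infinity>")
  case True
  then show ?thesis by (simp add: risk_def case_prod_beta')
next
  case False
  have [measurable]: "clip m f \<in> borel_measurable (Rd d)" unfolding clip_def[abs_def] by measurable
  define \<phi> where "\<phi> x = \<bar>f x - clip m f x\<bar> / m" for x
  have [measurable]: "\<phi> \<in> borel_measurable (Rd d)" unfolding \<phi>_def[abs_def] by measurable
  have \<phi>_nonneg: "0 \<le> \<phi> x" for x using m_pos by (simp add: \<phi>_def)
  have key: "(clip m f x - y)\<^sup>2 + \<phi> x * m\<^sup>2 \<le> (f x - y)\<^sup>2 + \<phi> x * y\<^sup>2" for x y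
  proof -
    \<comment> \<open>Trades |y| for y^2, the only quantity whose conditional mean is controlled;
      equivalently 2 m - 2 |y| \<ge> (m^2 - y^2) / m.\<close>
    have y: "2 * \<bar>y\<bar> \<le> (m\<^sup>2 + y\<^sup>2) / m"
      using m_pos zero_le_power2[of "m - \<bar>y\<bar>"] by (simp add: field_simps power2_eq_square)
    have "\<bar>f x - clip m f x\<bar> * ((m\<^sup>2 - y\<^sup>2) / m) \<le> \<bar>f x - clip m f x\<bar> * (2 * m - 2 * \<bar>y\<bar>)"
      using m_pos y by (intro mult_left_mono) (auto simp: field_simps power2_eq_square)
    also have "\<dots> \<le> (f x - clip m f x) * (f x + clip m f x - 2 * y)"
    proof -
      consider "f x > m" | "f x < - m" | "f x = clip m f x" unfolding clip_def by linarith
      then show ?thesis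
      proof cases
        case 1
        then have "clip m f x = m" using m_pos by (simp add: clip_def)
        with 1 show ?thesis by (auto intro!: mult_left_mono)
      next
        case 2
        then have c: "clip m f x = - m" using m_pos by (simp add: clip_def)
        have "(- m - f x) * (2 * m - 2 * \<bar>y\<bar>) \<le> (- m - f x) * (m - f x + 2 * y)"
          using 2 by (intro mult_left_mono) auto
        with 2 c show ?thesis by (simp add: algebra_simps abs_if)
      qed simp
    qed
    finally show ?thesis
      using m_pos by (simp add: \<phi>_def power2_eq_square field_simps)
  qed
  \<comment> \<open>Needed to cancel m^2 E \<phi>(X) from both sides below. It uses that the
    unclipped risk is finite: then f(X) - Y is square integrable, hence f(X) is integrable.\<close>
  have \<phi>_fin: "(\<integral>\<^sup>+z. ennreal (\<phi> (fst z)) \<partial>P) < \<infinity>"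
  proof -
    have int: "integrable P (\<lambda>z. (f (fst z) - snd z)\<^sup>2)"
      using False by (intro integrableI_nonneg) (auto simp: less_top)
    have "integrable P (\<lambda>z. f (fst z) - snd z)"
      by (rule square_integrable_imp_integrable[OF _ int]) measurable
    then have "integrable P (\<lambda>z. (f (fst z) - snd z) + snd z)"
      using integrable_response by (rule Bochner_Integration.integrable_add)
    then have "integrable P (\<lambda>z. f (fst z))" by simp
    moreover have "integrable P (\<lambda>z. clip m f (fst z))"
      using clip_bounded_predictors[of f d m] m_pos by (intro integrable_bounded[of _ m]) auto
    ultimately have "integrable P (\<lambda>z. \<phi> (fst z))"
      unfolding \<phi>_def by (intro Bochner_Integration.integrable_divide integrable_abs Bochner_Integration.integrable_diff)
    then show ?thesis
      using \<phi>_nonneg by (simp add: nn_integral_eq_integral)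
  qed
  let ?c = "\<integral>\<^sup>+z. ennreal (\<phi> (fst z)) \<partial>P"
  have "(\<integral>\<^sup>+z. ennreal ((clip m f (fst z) - snd z)\<^sup>2) \<partial>P) + ennreal (m\<^sup>2) * ?c
      = (\<integral>\<^sup>+z. ennreal ((clip m f (fst z) - snd z)\<^sup>2 + \<phi> (fst z) * m\<^sup>2) \<partial>P)"
    using \<phi>_nonneg by (simp add: ennreal_mult nn_integral_add nn_integral_multc mult.commute)
  also have "\<dots> \<le> (\<integral>\<^sup>+z. ennreal ((f (fst z) - snd z)\<^sup>2 + \<phi> (fst z) * (snd z)\<^sup>2) \<partial>P)"
    by (intro nn_integral_mono ennreal_leI key)
  also have "\<dots> = (\<integral>\<^sup>+z. ennreal ((f (fst z) - snd z)\<^sup>2) \<partial>P)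
      + (\<integral>\<^sup>+z. ennreal (\<phi> (fst z)) * ennreal ((snd z)\<^sup>2) \<partial>P)"
    using \<phi>_nonneg by (simp add: ennreal_mult nn_integral_add)
  also have "\<dots> \<le> (\<integral>\<^sup>+z. ennreal ((f (fst z) - snd z)\<^sup>2) \<partial>P) + ennreal (m\<^sup>2) * ?c"
    by (intro add_left_mono nn_integral_mult_response_le) measurable
  finally have "(\<integral>\<^sup>+z. ennreal ((clip m f (fst z) - snd z)\<^sup>2) \<partial>P)
      \<le> (\<integral>\<^sup>+z. ennreal ((f (fst z) - snd z)\<^sup>2) \<partial>P)"
    using \<phi>_fin by (auto simp: ennreal_mult_eq_top_iff add.commute[of _ "ennreal (m\<^sup>2) * ?c"]
        ennreal_add_left_cancel_le)
  then show ?thesis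
    by (simp add: risk_def case_prod_beta' less_eq_ennreal.rep_eq)
qed


section \<open>Simultaneous accuracy of all pairwise estimates\<close>

text \<open>With \<alpha> = 1 / (704 m^2), the bias \<alpha> / 2 * 16 m^2 equals 1 / 88 and 1 / (n
  \<alpha>) equals 704 m^2 / n.\<close>

lemma catoni_mean_excess_loss:
  assumes "f \<in> bounded_predictors d m" "g \<in> bounded_predictors d m" "n \<ge> 1"
  shows "measure (PiM {..<n} (\<lambda>_. P)) {s \<in> space (PiM {..<n} (\<lambda>_. P)).
      \<not> \<bar>catoni_mean (1 / (704 * m\<^sup>2)) n (excess_loss f g) s - (sq_risk f - sq_risk g)\<bar>
        \<le> sq_dist f g / 88 + 704 * m\<^sup>2 * L / n} \<le> 2 * exp (- L)"
  using catoni_mean_deviation[OF excess_loss_mean(1) excess_loss_second_moment(1) _ _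
      excess_loss_second_moment(2), OF assms(1,2,1,2) _ _ assms(1,2), of "1 / (704 * m\<^sup>2)" n L]
    assms m_pos
  by (simp add: excess_loss_mean(2) field_simps)

lemma catoni_mean_sq_diff:
  assumes "f \<in> bounded_predictors d m" "g \<in> bounded_predictors d m" "n \<ge> 1"
  shows "measure (PiM {..<n} (\<lambda>_. P)) {s \<in> space (PiM {..<n} (\<lambda>_. P)).
      \<not> \<bar>catoni_mean (1 / (704 * m\<^sup>2)) n (sq_diff f g) s - sq_dist f g\<bar>
        \<le> sq_dist f g / 88 + 704 * m\<^sup>2 * L / n} \<le> 2 * exp (- L)"
  using catoni_mean_deviation[OF integrable_sq_diff sq_diff_second_moment(1) _ _
      sq_diff_second_moment(2), OF assms(1,2,1,2) _ _ assms(1,2), of "1 / (704 * m\<^sup>2)" n L]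
    assms m_pos
  by (simp add: field_simps)

end

text \<open>Collects all the randomness: once a sample satisfies this, the rest of the risk analysis
  is deterministic.\<close>

definition (in regression_model) accurate ::
  "nat \<Rightarrow> ((nat \<Rightarrow> real) \<Rightarrow> real) set \<Rightarrow> real \<Rightarrow> (nat \<Rightarrow> (nat \<Rightarrow> real) \<times> real) \<Rightarrow> bool" where
  "accurate n G \<Lambda> s \<longleftrightarrow> (\<forall>f\<in>G. \<forall>g\<in>G.
     \<bar>catoni_mean (1 / (704 * m\<^sup>2)) n (excess_loss f g) s - (sq_risk f - sq_risk g)\<bar>
        \<le> sq_dist f g / 88 + \<Lambda> \<and>
     \<bar>catoni_mean (1 / (704 * m\<^sup>2)) n (sq_diff f g) s - sq_dist f g\<bar> \<le> sq_dist f g / 88 + \<Lambda>)"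

text \<open>Union bound over |G|^2 ordered pairs, two estimates per pair and two tails per
  estimate.\<close>

lemma (in regression_model) accurate_prob:
  assumes G: "finite G" "G \<subseteq> bounded_predictors d m" and n: "n \<ge> 1"
  shows "{s \<in> space (PiM {..<n} (\<lambda>_. P)). accurate n G (704 * m\<^sup>2 * L / n) s}
        \<in> sets (PiM {..<n} (\<lambda>_. P))"
    and "measure (PiM {..<n} (\<lambda>_. P))
        {s \<in> space (PiM {..<n} (\<lambda>_. P)). accurate n G (704 * m\<^sup>2 * L / n) s}
      \<ge> 1 - 4 * (real (card G))\<^sup>2 * exp (- L)"
proof -
  let ?N = "PiM {..<n} (\<lambda>_. P)"
  interpret N: product_prob_space "\<lambda>_. P" "{..<n}" by unfold_locales
  define \<Lambda> where "\<Lambda> = 704 * m\<^sup>2 * L / n"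
  define E1 where "E1 = (\<lambda>(f, g). {s \<in> space ?N.
      \<not> \<bar>catoni_mean (1 / (704 * m\<^sup>2)) n (excess_loss f g) s - (sq_risk f - sq_risk g)\<bar>
        \<le> sq_dist f g / 88 + \<Lambda>})"
  define E2 where "E2 = (\<lambda>(f, g). {s \<in> space ?N.
      \<not> \<bar>catoni_mean (1 / (704 * m\<^sup>2)) n (sq_diff f g) s - sq_dist f g\<bar> \<le> sq_dist f g / 88 + \<Lambda>})"
  have E_sets: "E1 p \<in> sets ?N" "E2 p \<in> sets ?N" if "p \<in> G \<times> G" for p
  proof -
    obtain f g where p: "p = (f, g)" by (cases p)
    have [measurable]: "f \<in> borel_measurable (Rd d)" "g \<in> borel_measurable (Rd d)"
      using that G p by auto
    note [measurable] = measurable_excess_loss measurable_sq_diff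
    show "E1 p \<in> sets ?N" "E2 p \<in> sets ?N"
      unfolding E1_def E2_def p prod.case by measurable
  qed
  have E_prob: "measure ?N (E1 p \<union> E2 p) \<le> 4 * exp (- L)" if "p \<in> G \<times> G" for p
  proof -
    obtain f g where p: "p = (f, g)" by (cases p)
    then have "f \<in> bounded_predictors d m" "g \<in> bounded_predictors d m" using that G by auto
    then have "measure ?N (E1 p) \<le> 2 * exp (- L)" "measure ?N (E2 p) \<le> 2 * exp (- L)"
      unfolding E1_def E2_def p \<Lambda>_def
      using catoni_mean_excess_loss[of f g n L] catoni_mean_sq_diff[of f g n L] n by simp_all
    moreover have "measure ?N (E1 p \<union> E2 p) \<le> measure ?N (E1 p) + measure ?N (E2 p)"
      using E_sets[OF that] by (intro measure_Un_le)
    ultimately show ?thesis by simp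
  qed
  let ?U = "\<Union>p\<in>G \<times> G. E1 p \<union> E2 p"
  have U_sets: "?U \<in> sets ?N"
    using G E_sets by (intro sets.finite_UN) auto
  have eq: "{s \<in> space ?N. accurate n G \<Lambda> s} = space ?N - ?U"
    unfolding accurate_def E1_def E2_def by auto
  show "{s \<in> space ?N. accurate n G (704 * m\<^sup>2 * L / n) s} \<in> sets ?N"
    using U_sets unfolding \<Lambda>_def[symmetric] eq by auto
  have "measure ?N ?U \<le> (\<Sum>p\<in>G \<times> G. measure ?N (E1 p \<union> E2 p))"
    using G E_sets by (intro N.finite_measure_subadditive_finite) auto
  also have "\<dots> \<le> (\<Sum>p\<in>G \<times> G. 4 * exp (- L))"
    by (intro sum_mono E_prob)
  also have "\<dots> = 4 * (real (card G))\<^sup>2 * exp (- L)"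
    by (simp add: card_cartesian_product power2_eq_square)
  finally show "measure ?N {s \<in> space ?N. accurate n G (704 * m\<^sup>2 * L / n) s}
      \<ge> 1 - 4 * (real (card G))\<^sup>2 * exp (- L)"
    using N.prob_compl[OF U_sets] unfolding \<Lambda>_def[symmetric] eq by simp
qed

section \<open>Deterministic comparison of risks from approximate risk differences and
  distances\<close>

text \<open>
  The scale \<open>1 / (704 m^2)\<close> turns the second moment \<open>16 m^2 E(f - g)^2\<close> into the error
  \<open>t E(f - g)^2\<close> with \<open>t = 1 / 88\<close>, small enough for the convexity gain to win. The constants below
  are \<open>2 t\<close> and \<open>1 + 2 t\<close>.
\<close>

definition admissible :: "('f \<Rightarrow> 'f \<Rightarrow> real) \<Rightarrow> ('f \<Rightarrow> 'f \<Rightarrow> real) \<Rightarrow> real \<Rightarrow> 'f set \<Rightarrow> 'f \<Rightarrow> bool" where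
  "admissible A B \<Lambda> G f \<longleftrightarrow> (\<forall>g\<in>G. A f g \<le> B f g / 44 + 45 / 44 * \<Lambda>)"

text \<open>Here \<open>A\<close> stands for estimated risk differences and \<open>B\<close> for
  estimated squared distances. Maximality of \<open>B f g\<close> bounds the distance from f to
  every admissible h, in particular to the unknown minimizer, by a multiple of the distance from f
  to g, up to \<Lambda>.\<close>

definition farthest_pair ::
  "('f \<Rightarrow> 'f \<Rightarrow> real) \<Rightarrow> ('f \<Rightarrow> 'f \<Rightarrow> real) \<Rightarrow> real \<Rightarrow> 'f set \<Rightarrow> 'f \<times> 'f \<Rightarrow> bool" where
  "farthest_pair A B \<Lambda> G = (\<lambda>(f, g). admissible A B \<Lambda> G f \<and> admissible A B \<Lambda> G g \<and>
     (\<forall>h\<in>G. admissible A B \<Lambda> G h \<longrightarrow> B f h \<le> B f g))"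

context
  fixes A B D :: "'f \<Rightarrow> 'f \<Rightarrow> real" and R :: "'f \<Rightarrow> real" and \<Lambda> :: real and G :: "'f set"
  assumes A: "\<And>f g. f \<in> G \<Longrightarrow> g \<in> G \<Longrightarrow> \<bar>A f g - (R f - R g)\<bar> \<le> D f g / 88 + \<Lambda>"
    and B: "\<And>f g. f \<in> G \<Longrightarrow> g \<in> G \<Longrightarrow> \<bar>B f g - D f g\<bar> \<le> D f g / 88 + \<Lambda>"
    and \<Lambda>_nonneg: "0 \<le> \<Lambda>"
    and D_nonneg: "\<And>f g. f \<in> G \<Longrightarrow> g \<in> G \<Longrightarrow> 0 \<le> D f g"
    and triangle: "\<And>f g h. f \<in> G \<Longrightarrow> g \<in> G \<Longrightarrow> h \<in> G \<Longrightarrow> D g h \<le> 2 * D f g + 2 * D f h"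
begin

lemma bounds:
  assumes "f \<in> G" "g \<in> G"
  shows "A f g \<le> R f - R g + D f g / 88 + \<Lambda>" "R f - R g \<le> A f g + D f g / 88 + \<Lambda>"
    "B f g \<le> D f g + D f g / 88 + \<Lambda>" "D f g \<le> B f g + D f g / 88 + \<Lambda>"
  using A[OF assms] B[OF assms] by (auto simp: abs_le_iff)

text \<open>Accuracy of \<open>B\<close> gives 0 \<le> D f g \<le> 2 (B f g + \<Lambda>). So the
  error D f g / 88 + \<Lambda> in \<open>A f g\<close> is at most (B f g + \<Lambda>) / 44 +
  \<Lambda>, which is the admissibility threshold.\<close>

lemma minimizer_admissible:
  assumes "f \<in> G" "\<And>g. g \<in> G \<Longrightarrow> R f \<le> R g"
  shows "admissible A B \<Lambda> G f"
  unfolding admissible_def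
proof
  fix g assume g: "g \<in> G"
  show "A f g \<le> B f g / 44 + 45 / 44 * \<Lambda>"
    using bounds[OF assms(1) g] D_nonneg[OF assms(1) g] assms(2)[OF g] by linarith
qed

text \<open>The admissible set is nonempty as it contains the minimizer, which serves here as first
  component; the estimator may select a different pair.\<close>

lemma farthest_pair_exists:
  assumes "finite G" "f \<in> G" "\<And>g. g \<in> G \<Longrightarrow> R f \<le> R g"
  shows "\<exists>p\<in>G \<times> G. farthest_pair A B \<Lambda> G p"
proof -
  let ?T = "{g \<in> G. admissible A B \<Lambda> G g}"
  have f: "f \<in> ?T" using assms minimizer_admissible by auto
  obtain g where "is_arg_min (\<lambda>g. - B f g) (\<lambda>g. g \<in> ?T) g"
    using ex_is_arg_min_if_finite[of ?T "\<lambda>g. - B f g"] assms(1) f by auto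
  then have "g \<in> ?T" "\<And>h. h \<in> ?T \<Longrightarrow> B f h \<le> B f g"
    by (auto simp: is_arg_min_linorder)
  with f show ?thesis
    by (intro bexI[of _ "(f, g)"]) (auto simp: farthest_pair_def)
qed

text \<open>Returns from the empirical test to true quantities. Using B f g \<le> 3/2 D f g +
  \<Lambda>, the coefficients are (3/2) / 44 + 1 / 88 = 1 / 22 for the distance and 1 / 44 + 45 / 44
  + 1 = 45 / 22 for \<Lambda>.\<close>

lemma admissible_excess:
  assumes "f \<in> G" "g \<in> G" "admissible A B \<Lambda> G f"
  shows "R f - R g \<le> D f g / 22 + 45 / 22 * \<Lambda>"
proof -
  have "A f g \<le> B f g / 44 + 45 / 44 * \<Lambda>" using assms by (auto simp: admissible_def)
  with bounds[OF assms(1,2)] D_nonneg[OF assms(1,2)] \<Lambda>_nonneg show ?thesis by linarith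
qed

text \<open>
  The distance from either admissible function to the minimizer is comparable to the distance
  between the two, so the strong convexity gain \<open>- D f g / 4\<close> absorbs their excess risks.
\<close>

lemma farthest_pair_midpoint_excess:
  assumes fg: "f \<in> G" "g \<in> G" "farthest_pair A B \<Lambda> G (f, g)"
    and h: "h \<in> G" "\<And>g. g \<in> G \<Longrightarrow> R h \<le> R g"
  shows "(R f + R g) / 2 - D f g / 4 \<le> R h + 3 * \<Lambda>"
proof -
  have adm: "admissible A B \<Lambda> G f" "admissible A B \<Lambda> G g" and far: "B f h \<le> B f g"
    using fg(3) minimizer_admissible[OF h] h(1) by (auto simp: farthest_pair_def)
  from far admissible_excess[OF fg(1) h(1) adm(1)] admissible_excess[OF fg(2) h(1) adm(2)]
    bounds[OF fg(1) h(1)] bounds[OF fg(1,2)] triangle[OF fg(1,2) h(1)] D_nonneg[OF fg(1,2)]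
    D_nonneg[OF fg(1) h(1)] D_nonneg[OF fg(2) h(1)]
    \<Lambda>_nonneg
  show ?thesis by argo
qed

end

section \<open>The midpoint estimator: measurability and risk\<close>

text \<open>The restriction supplies the extensionality demanded by
  \<open>measurable_functions\<close>; it leaves the risk unchanged because X takes values in
  R^d.\<close>

definition midpoint_predictor ::
  "nat \<Rightarrow> ((nat \<Rightarrow> real) \<Rightarrow> real) \<times> ((nat \<Rightarrow> real) \<Rightarrow> real) \<Rightarrow> (nat \<Rightarrow> real) \<Rightarrow> real" where
  "midpoint_predictor d = (\<lambda>(f, g). restrict (\<lambda>x. (f x + g x) / 2) (space (Rd d)))"

lemma midpoint_predictor_measurable:
  assumes "f \<in> borel_measurable (Rd d)" "g \<in> borel_measurable (Rd d)"
  shows "midpoint_predictor d (f, g) \<in> measurable_functions d"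
  unfolding measurable_functions_def midpoint_predictor_def using assms
  by (auto intro!: measurable_restrict_space1 cong: measurable_cong)

lemma (in regression_model) risk_midpoint_predictor:
  assumes "f \<in> bounded_predictors d m" "g \<in> bounded_predictors d m"
  shows "risk P (midpoint_predictor d (f, g)) = ereal ((sq_risk f + sq_risk g) / 2 - sq_dist f g / 4)"
proof -
  have [measurable]: "f \<in> borel_measurable (Rd d)" "g \<in> borel_measurable (Rd d)" using assms by auto
  have "(\<lambda>x. (f x + g x) / 2) \<in> bounded_predictors d m"
    unfolding bounded_predictors_def
  proof safe
    fix x
    have "\<bar>f x\<bar> \<le> m" "\<bar>g x\<bar> \<le> m" using assms by auto
    then show "\<bar>(f x + g x) / 2\<bar> \<le> m" by auto
  qed measurable
  moreover have "risk P (midpoint_predictor d (f, g)) = risk P (\<lambda>x. (f x + g x) / 2)"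
    unfolding risk_def midpoint_predictor_def case_prod_beta'
    by (intro arg_cong[where f=enn2ereal] nn_integral_cong) (simp add: fst_in_space)
  ultimately show ?thesis
    using assms by (simp add: risk_eq_sq_risk sq_risk_midpoint)
qed


text \<open>The selector takes finitely many values, so joint measurability reduces to that of each
  single midpoint.\<close>

lemma midpoint_predictor_estimator:
  assumes sel: "sel \<in> sample_space n d \<rightarrow>\<^sub>M count_space H" and "finite H"
    and H: "H \<subseteq> borel_measurable (Rd d) \<times> borel_measurable (Rd d)"
  shows "estimator n d (\<lambda>s. midpoint_predictor d (sel s))"
  unfolding estimator_def
proof
  have meas: "midpoint_predictor d p \<in> measurable_functions d" if "p \<in> H" for p
    using that H midpoint_predictor_measurable by (cases p) auto
  then show "\<forall>s\<in>space (sample_space n d). midpoint_predictor d (sel s) \<in> measurable_functions d"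
    using measurable_space[OF sel] by auto
  have "(\<lambda>p. midpoint_predictor d (sel (fst p)) (snd p)) \<in> borel_measurable (sample_space n d \<Otimes>\<^sub>M Rd d)"
  proof (rule measurable_compose_countable'[where I=H and f="\<lambda>h p. midpoint_predictor d h (snd p)"])
    show "(\<lambda>p. sel (fst p)) \<in> sample_space n d \<Otimes>\<^sub>M Rd d \<rightarrow>\<^sub>M count_space H"
      by (rule measurable_compose[OF measurable_fst sel])
    show "(\<lambda>p. midpoint_predictor d h (snd p)) \<in> borel_measurable (sample_space n d \<Otimes>\<^sub>M Rd d)"
      if "h \<in> H" for h
      by (rule measurable_compose[OF measurable_snd])
        (use meas[OF that] in \<open>simp add: measurable_functions_def\<close>)
  qed (use assms in \<open>simp add: countable_finite\<close>)
  then show "(\<lambda>(s, x). midpoint_predictor d (sel s) x) \<in> borel_measurable (sample_space n d \<Otimes>\<^sub>M Rd d)"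
    by (simp add: case_prod_beta')
qed

abbreviation empirical_farthest_pair ::
  "real \<Rightarrow> nat \<Rightarrow> real \<Rightarrow> ((nat \<Rightarrow> real) \<Rightarrow> real) set \<Rightarrow>
    ((nat \<Rightarrow> real) \<Rightarrow> real) \<times> ((nat \<Rightarrow> real) \<Rightarrow> real) \<Rightarrow> (nat \<Rightarrow> (nat \<Rightarrow> real) \<times> real) \<Rightarrow> bool" where
  "empirical_farthest_pair m n \<Lambda> G p s \<equiv>
    farthest_pair (\<lambda>f g. catoni_mean (1 / (704 * m\<^sup>2)) n (excess_loss f g) s)
      (\<lambda>f g. catoni_mean (1 / (704 * m\<^sup>2)) n (sq_diff f g) s) \<Lambda> G p"

lemma empirical_farthest_pair_sets:
  assumes "finite G" "G \<subseteq> borel_measurable (Rd d)" "p \<in> G \<times> G"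
  shows "{s \<in> space (sample_space n d). empirical_farthest_pair m n \<Lambda> G p s} \<in> sets (sample_space n d)"
proof -
  obtain f g where p: "p = (f, g)" "f \<in> G" "g \<in> G" using assms(3) by auto
  have meas: "catoni_mean \<alpha> n (excess_loss f g) \<in> borel_measurable (sample_space n d)"
    "catoni_mean \<alpha> n (sq_diff f g) \<in> borel_measurable (sample_space n d)"
    if "f \<in> G" "g \<in> G" for f g \<alpha>
    using that assms(2)
    by (auto intro!: measurable_catoni_mean measurable_excess_loss measurable_sq_diff)
  have adm: "Measurable.pred (sample_space n d)
      (\<lambda>s. admissible (\<lambda>f g. catoni_mean (1 / (704 * m\<^sup>2)) n (excess_loss f g) s)
        (\<lambda>f g. catoni_mean (1 / (704 * m\<^sup>2)) n (sq_diff f g) s) \<Lambda> G f)" if "f \<in> G" for f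
    unfolding admissible_def
  proof (rule pred_intros_finite(3)[OF assms(1)])
    fix g assume "g \<in> G"
    show "Measurable.pred (sample_space n d)
      (\<lambda>s. catoni_mean (1 / (704 * m\<^sup>2)) n (excess_loss f g) s
        \<le> catoni_mean (1 / (704 * m\<^sup>2)) n (sq_diff f g) s / 44 + 45 / 44 * \<Lambda>)"
      unfolding pred_def using \<open>f \<in> G\<close> \<open>g \<in> G\<close>
      by (intro borel_measurable_le borel_measurable_add borel_measurable_divide
          borel_measurable_const meas)
  qed
  show ?thesis
    unfolding p(1) farthest_pair_def prod.case pred_def[symmetric]
  proof (intro pred_intros_logic pred_intros_finite(3) assms(1) adm p)
    fix h assume "h \<in> G"
    show "Measurable.pred (sample_space n d)
      (\<lambda>s. catoni_mean (1 / (704 * m\<^sup>2)) n (sq_diff f h) s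
        \<le> catoni_mean (1 / (704 * m\<^sup>2)) n (sq_diff f g) s)"
      unfolding pred_def using \<open>h \<in> G\<close> p(2,3) by (intro borel_measurable_le meas)
  qed
qed

text \<open>On an accurate sample a farthest pair exists, so the conditional guarantee of the
  selector becomes effective and the deterministic bound applies to the selected pair.\<close>

lemma (in regression_model) empirical_farthest_pair_risk:
  assumes G: "finite G" "G \<subseteq> bounded_predictors d m" and n: "n \<ge> 1" and L: "0 \<le> L"
    and s: "accurate n G (704 * m\<^sup>2 * L / n) s" and h: "h \<in> G"
    and sel: "p \<in> G \<times> G" "\<And>q. q \<in> G \<times> G \<Longrightarrow>
      empirical_farthest_pair m n (704 * m\<^sup>2 * L / n) G q s \<Longrightarrow>
      empirical_farthest_pair m n (704 * m\<^sup>2 * L / n) G p s"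
  shows "risk P (midpoint_predictor d p) \<le> ereal (sq_risk h + 3 * (704 * m\<^sup>2 * L / n))"
proof -
  define \<Lambda> where "\<Lambda> = 704 * m\<^sup>2 * L / n"
  have bd: "f \<in> bounded_predictors d m" if "f \<in> G" for f using that G by auto
  obtain k where "is_arg_min sq_risk (\<lambda>f. f \<in> G) k"
    using ex_is_arg_min_if_finite[of G sq_risk] G(1) h by auto
  then have k: "k \<in> G" "\<And>f. f \<in> G \<Longrightarrow> sq_risk k \<le> sq_risk f"
    by (auto simp: is_arg_min_linorder)
  let ?A = "\<lambda>f g. catoni_mean (1 / (704 * m\<^sup>2)) n (excess_loss f g) s"
  let ?B = "\<lambda>f g. catoni_mean (1 / (704 * m\<^sup>2)) n (sq_diff f g) s"
  have approx: "\<bar>?A f g - (sq_risk f - sq_risk g)\<bar> \<le> sq_dist f g / 88 + \<Lambda>"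
    "\<bar>?B f g - sq_dist f g\<bar> \<le> sq_dist f g / 88 + \<Lambda>" if "f \<in> G" "g \<in> G" for f g
    using s that by (auto simp: accurate_def \<Lambda>_def)
  have \<Lambda>: "\<Lambda> \<ge> 0" using L by (simp add: \<Lambda>_def)
  have nonneg: "sq_dist f g \<ge> 0" for f g
    by (simp add: sq_diff_def)
  note tri = sq_dist_triangle[OF bd bd bd]
  obtain q where "q \<in> G \<times> G" "farthest_pair ?A ?B \<Lambda> G q"
    using farthest_pair_exists[of G ?A sq_risk sq_dist \<Lambda> ?B, OF approx \<Lambda> nonneg tri G(1) k] by blast
  with sel have far: "farthest_pair ?A ?B \<Lambda> G p" by (auto simp: \<Lambda>_def)
  obtain f g where p: "p = (f, g)" "f \<in> G" "g \<in> G" using sel(1) by auto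
  have "(sq_risk f + sq_risk g) / 2 - sq_dist f g / 4 \<le> sq_risk k + 3 * \<Lambda>"
    using farthest_pair_midpoint_excess[of G ?A sq_risk sq_dist \<Lambda> ?B, OF approx \<Lambda> nonneg tri p(2,3) _ k]
      far p by blast
  also have "sq_risk k \<le> sq_risk h" using k h by auto
  finally show ?thesis
    using bd p by (simp add: risk_midpoint_predictor \<Lambda>_def)
qed

section \<open>Choice of parameters and conclusion\<close>

theorem theorem4:
  "\<exists>c::real. c > 0 \<and>
     (\<forall>(n::nat) (d::nat) (m::real) (\<delta>::real) (F :: ((nat \<Rightarrow> real) \<Rightarrow> real) set).
        n \<ge> 1 \<longrightarrow> d \<ge> 1 \<longrightarrow> m > 0 \<longrightarrow> 0 < \<delta> \<longrightarrow> \<delta> < 1 \<longrightarrow>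
        finite F \<longrightarrow> F \<noteq> {} \<longrightarrow> F \<subseteq> measurable_functions d \<longrightarrow>
        (\<exists>ghat. estimator n d ghat \<and>
           (\<forall>P. data_distribution d P \<longrightarrow> cond_second_moment_le d m P \<longrightarrow>
              measure (PiM {..<n} (\<lambda>_. P))
                {s \<in> space (PiM {..<n} (\<lambda>_. P)).
                   risk P (ghat s) - (MIN g\<in>F. risk P g)
                     \<le> ereal (c * (m\<^sup>2 * (ln (real (card F)) + ln (1 / \<delta>)) / real n))}
              \<ge> 1 - \<delta>)))"
\<comment> \<open>8448 = 3 * 704 * 4: the excess is at most 3 \<Lambda> with \<Lambda> = 704 m^2 L /
  n, and L \<le> 4 (ln M + ln (1 / \<delta>)) when M \<ge> 2.\<close>
proof (intro exI[of _ 8448] conjI allI impI)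
  fix n d :: nat and m \<delta> :: real and F :: "((nat \<Rightarrow> real) \<Rightarrow> real) set"
  assume n: "1 \<le> n" and m: "0 < m" and \<delta>: "0 < \<delta>" "\<delta> < 1"
    and F: "finite F" "F \<noteq> {}" "F \<subseteq> measurable_functions d"
  define G where "G = clip m ` F"
  define M where "M = card F"
  \<comment> \<open>Makes the union bound 4 M^2 exp (- L) equal to \<delta>. Clipping may identify
    functions, so \<open>card G\<close> can be smaller than \<open>M\<close>, which only lowers the
    failure probability.\<close>
  define L where "L = ln (4 * (real M)\<^sup>2 / \<delta>)"
  define \<Lambda> where "\<Lambda> = 704 * m\<^sup>2 * L / n"
  define t where "t = 8448 * (m\<^sup>2 * (ln (real M) + ln (1 / \<delta>)) / real n)"
  have M: "M \<ge> 1" using F by (simp add: M_def Suc_le_eq card_gt_0_iff)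
  then have M_sq: "(real M)\<^sup>2 \<ge> 1" by (simp add: one_le_power)
  have L: "L \<ge> 0" unfolding L_def using M_sq \<delta> by (simp add: field_simps)
  have exp_L: "4 * (real M)\<^sup>2 * exp (- L) = \<delta>"
    using M \<delta> by (simp add: L_def exp_minus)
  have t_nonneg: "t \<ge> 0"
    using M \<delta> by (simp add: t_def)
  have G: "finite G" "G \<noteq> {}" "G \<subseteq> bounded_predictors d m" and card_G: "card G \<le> M"
    using F m clip_bounded_predictors[of _ d m]
    by (auto simp: G_def M_def measurable_functions_def intro: card_image_le)
  then have G_meas: "G \<subseteq> borel_measurable (Rd d)" by auto
  have "finite (G \<times> G)" "G \<times> G \<noteq> {}" using G by auto
  \<comment> \<open>The selection criterion involves only m, n, \<Lambda>, G and the sample, so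
    \<open>sel\<close> is fixed before any distribution P is considered.\<close>
  then have "\<exists>sel \<in> sample_space n d \<rightarrow>\<^sub>M count_space (G \<times> G). (\<forall>s. sel s \<in> G \<times> G) \<and>
      (\<forall>s. \<forall>p\<in>G \<times> G. empirical_farthest_pair m n \<Lambda> G p s \<longrightarrow> empirical_farthest_pair m n \<Lambda> G (sel s) s)"
    using empirical_farthest_pair_sets[OF G(1) G_meas] by (rule finite_measurable_selection)
  then obtain sel where sel: "sel \<in> sample_space n d \<rightarrow>\<^sub>M count_space (G \<times> G)" "\<forall>s. sel s \<in> G \<times> G"
    "\<forall>s. \<forall>p\<in>G \<times> G. empirical_farthest_pair m n \<Lambda> G p s \<longrightarrow> empirical_farthest_pair m n \<Lambda> G (sel s) s"
    by (elim bexE conjE)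
  define ghat where "ghat s = midpoint_predictor d (sel s)" for s
  have "estimator n d ghat"
    unfolding ghat_def using sel(1) G G_meas by (intro midpoint_predictor_estimator) auto
  moreover have "1 - \<delta> \<le> measure (PiM {..<n} (\<lambda>_. P))
      {s \<in> space (PiM {..<n} (\<lambda>_. P)). risk P (ghat s) - (MIN g\<in>F. risk P g) \<le> ereal t}"
    (is "_ \<le> measure ?N ?good") if "data_distribution d P" "cond_second_moment_le d m P" for P
  proof -
    interpret regression_model d m P
      using that m by unfold_locales
    interpret N: product_prob_space "\<lambda>_. P" "{..<n}" by unfold_locales
    have "(MIN g\<in>F. risk P g) \<in> risk P ` F" using F by (intro Min_in) auto
    then obtain g where g: "g \<in> F" "risk P g = (MIN g\<in>F. risk P g)" by auto
    \<comment> \<open>The clipped minimizer links the two classes: it lies in \<open>G\<close> and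
      its risk is at most the minimal risk over \<open>F\<close>.\<close>
    let ?h = "clip m g"
    have h: "?h \<in> G" "?h \<in> bounded_predictors d m" using g(1) G by (auto simp: G_def)
    have "ereal (sq_risk ?h) = risk P ?h" using risk_eq_sq_risk[OF h(2)] by simp
    also have "\<dots> \<le> risk P g"
      using g(1) F by (intro risk_clip_le) (auto simp: measurable_functions_def)
    finally have min: "ereal (sq_risk ?h) \<le> (MIN g\<in>F. risk P g)" using g by simp
    \<comment> \<open>The minimum over \<open>F\<close> may be infinite. The risk of the output is
      finite here, so the extended difference is then minus infinity and the bound still
      holds.\<close>
    have good: "s \<in> ?good" if "s \<in> space ?N" "risk P (ghat s) \<le> ereal (sq_risk ?h + t)" for s
    proof -
      have "risk P (ghat s) \<le> ereal t + ereal (sq_risk ?h)" using that by (simp add: add.commute)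
      also have "\<dots> \<le> ereal t + (MIN g\<in>F. risk P g)" by (intro add_left_mono min)
      finally have "risk P (ghat s) \<le> ereal t + (MIN g\<in>F. risk P g)" .
      moreover have "risk P (ghat s) \<noteq> \<infinity>" using that by auto
      ultimately show ?thesis
        using that min
        by (cases "risk P (ghat s)"; cases "MIN g\<in>F. risk P g") auto
    qed
    have sets_N: "sets ?N = sets (sample_space n d)"
      by (intro sets_PiM_cong refl sets_P)
    have sel_N: "sel \<in> ?N \<rightarrow>\<^sub>M count_space (G \<times> G)"
      using sel(1) by (simp add: measurable_cong_sets[OF sets_N refl])
    \<comment> \<open>The risk of the output factors through the discrete-valued selector, which
      gives its measurability in the sample.\<close>
    have "(\<lambda>p. risk P (midpoint_predictor d p)) \<in> borel_measurable (count_space (G \<times> G))" by simp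
    from measurable_compose[OF sel_N this] have [measurable]: "(\<lambda>s. risk P (ghat s)) \<in> borel_measurable ?N"
      by (simp add: ghat_def)
    have good_sets: "?good \<in> sets ?N" by measurable
    show ?thesis
    \<comment> \<open>The term ln 4 in L can be absorbed by 2 ln M only if M \<ge> 2. For M = 1 the
      logarithm vanishes and \<delta> may be close to 1, but the midpoint is then the single clipped
      function and the bound holds on every sample.\<close>
    proof (cases "M = 1")
      case True
      then obtain g' where "F = {g'}" using card_1_singletonE M_def by metis
      then have "G = {?h}" using g by (simp add: G_def)
      then have "sel s = (?h, ?h)" for s using sel(2)[rule_format, of s] by auto
      then have "risk P (ghat s) = ereal (sq_risk ?h)" for s
        using h by (simp add: ghat_def risk_midpoint_predictor sq_diff_def[abs_def])
      then have "?good = space ?N" using good t_nonneg by auto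
      then show ?thesis
        using \<delta> prob_space.prob_space[OF prob_space_PiM[OF prob_space_axioms], of "{..<n}"] by simp
    next
      case False
      then have M2: "real M \<ge> 2" using M by linarith
      then have ln4: "ln 4 \<le> 2 * ln (real M)"
        using ln_mono[of 4 "(real M)\<^sup>2"] power_mono[of 2 "real M" 2] by (simp add: ln_realpow)
      have "L \<le> 4 * (ln (real M) + ln (1 / \<delta>))"
      proof -
        have eq: "L = ln 4 + 2 * ln (real M) - ln \<delta>" "ln (1 / \<delta>) = - ln \<delta>"
          using M2 \<delta> by (simp_all add: L_def ln_div ln_mult ln_realpow)
        have "ln \<delta> \<le> 0" using \<delta> by simp
        with ln4 show ?thesis unfolding eq by argo
      qed
      then have "2112 * m\<^sup>2 / n * L \<le> 2112 * m\<^sup>2 / n * (4 * (ln (real M) + ln (1 / \<delta>)))"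
        by (intro mult_left_mono) auto
      then have "3 * \<Lambda> \<le> t"
        unfolding \<Lambda>_def t_def by (simp add: mult_ac)
      have "{s \<in> space ?N. accurate n G \<Lambda> s} \<subseteq> ?good"
      proof
        fix s assume "s \<in> {s \<in> space ?N. accurate n G \<Lambda> s}"
        then have s: "s \<in> space ?N" "accurate n G \<Lambda> s" by auto
        have "risk P (ghat s) \<le> ereal (sq_risk ?h + 3 * \<Lambda>)"
          unfolding ghat_def \<Lambda>_def
          by (rule empirical_farthest_pair_risk[OF G(1,3) n L])
            (use s h(1) sel(2,3)[rule_format] in \<open>simp_all add: \<Lambda>_def\<close>)
        also have "\<dots> \<le> ereal (sq_risk ?h + t)" using \<open>3 * \<Lambda> \<le> t\<close> by simp
        finally show "s \<in> ?good" using s by (intro good)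
      qed
      then have "measure ?N {s \<in> space ?N. accurate n G \<Lambda> s} \<le> measure ?N ?good"
        by (intro N.finite_measure_mono good_sets)
      moreover have "1 - 4 * (real (card G))\<^sup>2 * exp (- L) \<le> measure ?N {s \<in> space ?N. accurate n G \<Lambda> s}"
        unfolding \<Lambda>_def by (rule accurate_prob[OF G(1,3) n])
      moreover have "4 * (real (card G))\<^sup>2 * exp (- L) \<le> \<delta>"
        unfolding exp_L[symmetric] using card_G by (intro mult_right_mono mult_left_mono power_mono) auto
      ultimately show ?thesis by linarith
    qed
  qed
  ultimately show "\<exists>ghat. estimator n d ghat \<and>
      (\<forall>P. data_distribution d P \<longrightarrow> cond_second_moment_le d m P \<longrightarrow>
        measure (PiM {..<n} (\<lambda>_. P))
          {s \<in> space (PiM {..<n} (\<lambda>_. P)). risk P (ghat s) - (MIN g\<in>F. risk P g)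
            \<le> ereal (8448 * (m\<^sup>2 * (ln (real (card F)) + ln (1 / \<delta>)) / real n))}
        \<ge> 1 - \<delta>)"
    unfolding t_def M_def by blast
qed simp

end
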